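(* The diameter of each connected component of the orthogonality graph $\Gamma_O(\mathbb{S})$ of the sedenions equals $3$.
   Context: Cayley-Dickson conventions. Let $\mathcal{M}_0=\mathbb{R}$ with trivial involution, and let $\mathcal{M}_{n+1}=\mathcal{M}_n\times\mathcal{M}_n$ with componentwise real vector space structure, product $(a,b)(c,d)=(ac-\bar d b,\ da+b\bar c)$ and involution $\overline{(a,b)}=(\bar a,-b)$. The sedenions are $\mathbb{S}=\mathcal{M}_4$. $Z(\mathbb{S})$ denotes the set of zero divisors, i.e. nonzero $u\in\mathbb{S}$ for which there is a nonzero $v\in\mathbb{S}$ with $uv=0$ or $vu=0$ (in $\mathbb{S}$, $uv=0$ if and only if $vu=0$). The orthogonality graph $\Gamma_O(\mathbb{S})$ is the undirected graph whose vertices are the lines $[u]=\mathbb{R}u$, $u\in Z(\mathbb{S})$, in which distinct vertices $[u],[v]$ are adjacent iff $uv=vu=0$. The diameter of a graph is the supremum of the distances between its vertices. *)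

theory Defs
  imports Complex_Main "Graph_Theory.Graph_Theory"
begin

section \<open>Cayley--Dickson doubling and the sedenions\<close>

class involution =
  fixes involution :: "'a \<Rightarrow> 'a"

instantiation real :: involution
begin
definition involution_real :: "real \<Rightarrow> real" where "involution_real x = x"
instance ..
end

text \<open>The type \<open>'a cayley_dickson\<close> is the set of pairs over \<open>'a\<close>. It is not the product type, whose
  two components may have different types, which would not allow the twisted product below.\<close>

datatype 'a cayley_dickson = CD (cd_fst: 'a) (cd_snd: 'a)

instantiation cayley_dickson :: (real_vector) real_vector
begin

definition "0 = CD 0 0"
definition "x + y = CD (cd_fst x + cd_fst y) (cd_snd x + cd_snd y)"
definition "- x = CD (- cd_fst x) (- cd_snd x)"
definition "x - y = CD (cd_fst x - cd_fst y) (cd_snd x - cd_snd y)"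
definition "r *\<^sub>R x = CD (r *\<^sub>R cd_fst x) (r *\<^sub>R cd_snd x)"

instance
  by standard
    (simp_all add: zero_cayley_dickson_def plus_cayley_dickson_def uminus_cayley_dickson_def
      minus_cayley_dickson_def scaleR_cayley_dickson_def cayley_dickson.expand
      scaleR_add_left scaleR_add_right)

end

instantiation cayley_dickson :: ("{uminus, involution}") involution
begin
definition involution_cayley_dickson :: "'a cayley_dickson \<Rightarrow> 'a cayley_dickson" where
  "involution_cayley_dickson x = CD (involution (cd_fst x)) (- cd_snd x)"
instance ..
end

instantiation cayley_dickson :: ("{plus, minus, times, involution}") times
begin
definition times_cayley_dickson ::
    "'a cayley_dickson \<Rightarrow> 'a cayley_dickson \<Rightarrow> 'a cayley_dickson" where
  "x * y = (case (x, y) of (CD a b, CD c d) \<Rightarrow>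
     CD (a * c - involution d * b) (d * a + b * involution c))"
instance ..
end

type_synonym sedenion = "real cayley_dickson cayley_dickson cayley_dickson cayley_dickson"


section \<open>The orthogonality graph\<close>

definition sedenion_zero_divisors :: "sedenion set" where
  "sedenion_zero_divisors = {u. u \<noteq> 0 \<and> (\<exists>v. v \<noteq> 0 \<and> (u * v = 0 \<or> v * u = 0))}"

text \<open>The vertex of \<open>u\<close> is the line \<open>\<real>u\<close>, as a set of sedenions. Undirected graphs are represented,
  as usual for \<open>pair_pre_digraph\<close>, by symmetric sets of ordered pairs.\<close>

definition sedenion_orthogonality_graph :: "sedenion set pair_pre_digraph" where
  "sedenion_orthogonality_graph =
     \<lparr> pverts = {span {u} | u. u \<in> sedenion_zero_divisors},
       parcs = {(span {u}, span {v}) | u v.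
         u \<in> sedenion_zero_divisors \<and> v \<in> sedenion_zero_divisors \<and>
         span {u} \<noteq> span {v} \<and> u * v = 0 \<and> v * u = 0} \<rparr>"

lemma pair_bidirected_digraph_sedenion_orthogonality_graph:
  "pair_bidirected_digraph sedenion_orthogonality_graph"
  by unfold_locales (auto simp: sedenion_orthogonality_graph_def symmetric_def sym_def)


section \<open>Distance and diameter\<close>

text \<open>With unit weights the cost of a walk is its length, so \<open>\<mu>\<close> is the graph distance; it is
  \<open>\<infinity>\<close> if there is no walk.\<close>

definition graph_distance :: "('a, 'b) pre_digraph \<Rightarrow> 'a \<Rightarrow> 'a \<Rightarrow> ereal" where
  "graph_distance G = wf_digraph.\<mu> G (\<lambda>_. 1)"

definition graph_diameter :: "('a, 'b) pre_digraph \<Rightarrow> ereal" where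
  "graph_diameter G = (SUP u\<in>verts G. SUP v\<in>verts G. graph_distance G u v)"

text \<open>The connected components of an undirected graph are the strongly connected components of the
  corresponding symmetric digraph, as induced subgraphs.\<close>

definition connected_components :: "'a pair_pre_digraph \<Rightarrow> ('a, 'a \<times> 'a) pre_digraph set" where
  "connected_components G = pre_digraph.sccs (with_proj G)"

end

theory Submission
  imports Defs "HOL-Analysis.Analysis"
begin

text \<open>
  Write a sedenion as a pair \<open>u = (a, b)\<close> of octonions. The octonions form an alternative algebra with
  a multiplicative norm, and this alone controls the zero divisors. If \<open>(a, b) (c, d) = 0\<close> with both
  factors nonzero, then eliminating \<open>d\<close> from the two component equations gives
  \<open>(a c) b\<^sup>* = - a (c b\<^sup>*)\<close>, where \<open>b\<^sup>*\<close> is the conjugate. So the associator of \<open>a, c, b\<^sup>*\<close> is as long as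
  the triangle inequality permits, namely \<open>2 \<bar>a\<bar> \<bar>c\<bar> \<bar>b\<bar>\<close>. As the associator is alternating and
  vanishes on \<open>1\<close>, moving one entry in the direction of \<open>1\<close> or of another entry does not change it,
  hence cannot shorten that entry: the three entries are imaginary and pairwise orthogonal
  (\<open>antiassociative_imp_imaginary_orthogonal\<close>). Thus zero divisors are the pairs of orthogonal
  imaginary octonions of equal nonzero norm.

  To such a pair belongs a unit imaginary octonion, its axis \<open>a b / \<bar>a\<bar>\<^sup>2\<close>, which depends only on the
  line of \<open>u\<close>. Two zero divisors \<open>(a, b)\<close> and \<open>(c, d)\<close> multiply to zero if and only if their axes are
  opposite and \<open>c\<close> is orthogonal to \<open>a\<close> and \<open>b\<close> (\<open>zero_product_iff\<close>). For a given axis \<open>k\<close> the first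
  entry \<open>a\<close>, orthogonal to \<open>1\<close> and \<open>k\<close>, determines \<open>b = - a k\<close>.

  Along an edge the axis changes sign, so in a component all axes are \<open>k\<close> or \<open>- k\<close>, and the component
  is bipartite. A common neighbour of two vertices with the same axis needs a first entry orthogonal
  to \<open>1\<close>, \<open>k\<close> and the four entries of the two pairs, and six conditions have a nonzero solution in
  dimension 8 (\<open>common_neighbour\<close>). So vertices with the same axis have distance at most 2, and,
  after one step to a neighbour, vertices with opposite axes have distance at most 3. The bound is
  attained by \<open>(a, b)\<close> and \<open>(a, - b)\<close>: their axes are opposite, so their distance is odd, and it is not
  1 because \<open>a\<close> is not orthogonal to itself.
\<close>

section \<open>Doubling a Euclidean space\<close>

notation involution (\<open>cj\<close>)

lemmas cayley_dickson_defs =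
  zero_cayley_dickson_def plus_cayley_dickson_def uminus_cayley_dickson_def
  minus_cayley_dickson_def scaleR_cayley_dickson_def involution_cayley_dickson_def
  times_cayley_dickson_def

instantiation cayley_dickson :: (real_inner) real_inner
begin

definition inner_cayley_dickson_def:
  "inner x y = inner (cd_fst x) (cd_fst y) + inner (cd_snd x) (cd_snd y)"

definition norm_cayley_dickson_def:
  "norm (x :: 'a cayley_dickson) = sqrt (inner x x)"

definition sgn_cayley_dickson_def:
  "sgn (x :: 'a cayley_dickson) = x /\<^sub>R norm x"

definition dist_cayley_dickson_def:
  "dist (x :: 'a cayley_dickson) y = norm (x - y)"

definition uniformity_cayley_dickson_def:
  "(uniformity :: ('a cayley_dickson \<times> 'a cayley_dickson) filter) =
     (INF e\<in>{0 <..}. principal {(x, y). dist x y < e})"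

definition open_cayley_dickson_def:
  "open (U :: 'a cayley_dickson set) \<longleftrightarrow>
     (\<forall>x\<in>U. eventually (\<lambda>(x', y). x' = x \<longrightarrow> y \<in> U) uniformity)"

instance
proof
  fix x y z :: "'a cayley_dickson" and r :: real
  show "inner x y = inner y x"
    by (simp add: inner_cayley_dickson_def inner_commute)
  show "inner (x + y) z = inner x z + inner y z" "inner (r *\<^sub>R x) y = r * inner x y"
    by (simp_all add: inner_cayley_dickson_def cayley_dickson_defs inner_add_left distrib_left)
  show "0 \<le> inner x x"
    by (simp add: inner_cayley_dickson_def)
  show "inner x x = 0 \<longleftrightarrow> x = 0"
    by (simp add: inner_cayley_dickson_def cayley_dickson_defs add_nonneg_eq_0_iff
        cayley_dickson.expand cayley_dickson.case_eq_if)
       (auto simp: cayley_dickson.expand)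
qed (simp_all add: norm_cayley_dickson_def sgn_cayley_dickson_def dist_cayley_dickson_def
      uniformity_cayley_dickson_def open_cayley_dickson_def)

end

instantiation cayley_dickson :: (euclidean_space) euclidean_space
begin

definition Basis_cayley_dickson_def:
  "Basis = (\<lambda>u. CD u 0) ` Basis \<union> (\<lambda>v. CD 0 v) ` Basis"

instance
proof
  fix u v x :: "'a cayley_dickson"
  show "(Basis :: 'a cayley_dickson set) \<noteq> {}" "finite (Basis :: 'a cayley_dickson set)"
    by (simp_all add: Basis_cayley_dickson_def)
  show "inner u v = (if u = v then 1 else 0)" if "u \<in> Basis" "v \<in> Basis"
    using that
    by (auto simp: Basis_cayley_dickson_def inner_cayley_dickson_def inner_Basis split: if_splits)
  show "(\<forall>u\<in>Basis. inner x u = 0) \<longleftrightarrow> x = 0"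
    unfolding Basis_cayley_dickson_def ball_Un ball_simps
    by (cases x) (simp add: inner_cayley_dickson_def euclidean_all_zero_iff zero_cayley_dickson_def)
qed

end

lemma DIM_cayley_dickson [simp]:
  "DIM('a::euclidean_space cayley_dickson) = 2 * DIM('a)"
proof -
  have "0 \<notin> (Basis :: 'a set)"
    by (metis inner_Basis inner_zero_left zero_neq_one)
  then have "card (((\<lambda>u::'a. CD u 0) ` Basis) \<union> ((\<lambda>v. CD 0 v) ` Basis)) = DIM('a) + DIM('a)"
    by (subst card_Un_disjoint) (auto simp: card_image inj_on_def)
  then show ?thesis
    by (simp add: Basis_cayley_dickson_def)
qed

lemma inner_CD [simp]: "inner (CD a b) (CD c d) = inner a c + inner b d"
  by (simp add: inner_cayley_dickson_def)

lemma zero_CD_iff [simp]: "CD a b = 0 \<longleftrightarrow> a = 0 \<and> b = 0"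
  by (simp add: zero_cayley_dickson_def)

lemma scaleR_CD [simp]: "r *\<^sub>R CD a b = CD (r *\<^sub>R a) (r *\<^sub>R b)"
  by (simp add: scaleR_cayley_dickson_def)

lemma minus_CD [simp]: "- CD a b = CD (- a) (- b)"
  by (simp add: uminus_cayley_dickson_def)

lemma add_CD [simp]: "CD a b + CD c d = CD (a + c) (b + d)"
  by (simp add: plus_cayley_dickson_def)

lemma mult_CD [simp]:
  "CD a b * CD c d = CD (a * c - cj d * b) (d * a + b * cj c)"
  for a b :: "'a::{plus, minus, times, involution}"
  by (simp add: times_cayley_dickson_def)

lemma cj_CD [simp]: "cj (CD a b) = CD (cj a) (- b)"
  by (simp add: involution_cayley_dickson_def)

section \<open>Cayley--Dickson algebras\<close>

text \<open>
  The properties that survive every doubling: a bilinear product with unit and an involution that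
  reverses products, fixes the real line and negates its orthogonal complement, and for which left
  multiplication by the conjugate is the adjoint of left multiplication.
\<close>

class cd_algebra = euclidean_space + times + one + involution +
  assumes cd_distrib_right: "(x + y) * z = x * z + y * z"
    and cd_distrib_left: "x * (y + z) = x * y + x * z"
    and cd_scaleR_left [simp]: "(r *\<^sub>R x) * y = r *\<^sub>R (x * y)"
    and cd_scaleR_right [simp]: "x * (r *\<^sub>R y) = r *\<^sub>R (x * y)"
    and cd_one_left [simp]: "1 * x = x"
    and cd_one_right [simp]: "x * 1 = x"
    and inner_one_one [simp]: "inner 1 1 = 1"
    and add_cj: "x + cj x = (2 * inner x 1) *\<^sub>R 1"
    and cj_mult: "cj (x * y) = cj y * cj x"
    and inner_mult_left_adjoint: "inner (x * y) z = inner y (cj x * z)"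

lemma cj_eq: "cj x = (2 * inner x 1) *\<^sub>R 1 - x"
  for x :: "'a::cd_algebra"
  using add_cj[of x] by (simp add: algebra_simps)

lemma cj_add [simp]: "cj (x + y) = cj x + cj y"
  for x y :: "'a::cd_algebra"
  by (simp add: cj_eq inner_add_left algebra_simps)

lemma cj_scaleR [simp]: "cj (r *\<^sub>R x) = r *\<^sub>R cj x"
  for x :: "'a::cd_algebra"
  by (simp add: cj_eq algebra_simps)

lemma cj_zero [simp]: "cj 0 = (0 :: 'a::cd_algebra)"
  by (simp add: cj_eq)

lemma cj_one [simp]: "cj 1 = (1 :: 'a::cd_algebra)"
  by (simp add: cj_eq scaleR_2)

lemma cj_minus [simp]: "cj (- x) = - cj x"
  for x :: "'a::cd_algebra"
  by (simp add: cj_eq)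

lemma cj_diff [simp]: "cj (x - y) = cj x - cj y"
  for x y :: "'a::cd_algebra"
  using cj_add[of x "- y"] by simp

lemma cj_cj [simp]: "cj (cj x) = x"
  for x :: "'a::cd_algebra"
proof -
  have "inner (cj x) 1 = inner x 1"
    by (simp add: cj_eq[of x] inner_diff_left)
  then show ?thesis
    by (simp add: cj_eq[of "cj x"]) (simp add: cj_eq)
qed

lemma inner_cj_cj [simp]: "inner (cj x) (cj y) = inner x y"
  for x y :: "'a::cd_algebra"
  by (simp add: cj_eq inner_diff_left inner_diff_right inner_commute algebra_simps)

lemma norm_cj [simp]: "norm (cj x) = norm x"
  for x :: "'a::cd_algebra"
  by (simp add: norm_eq_sqrt_inner)

lemma inner_cj_left: "inner (cj x) y = inner x (cj y)"
  for x y :: "'a::cd_algebra"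
  using inner_cj_cj[of x "cj y"] by simp

lemma cj_imaginary: "inner x 1 = 0 \<Longrightarrow> cj x = - x"
  for x :: "'a::cd_algebra"
  by (simp add: cj_eq)

text \<open>The involution is an isometry that exchanges left and right multiplication.\<close>

lemma inner_mult_right_adjoint: "inner (x * y) z = inner x (z * cj y)"
  for x y z :: "'a::cd_algebra"
proof -
  have "inner (x * y) z = inner (cj y * cj x) (cj z)"
    by (metis cj_mult inner_cj_cj)
  also have "\<dots> = inner (cj x) (y * cj z)"
    by (simp add: inner_mult_left_adjoint)
  also have "\<dots> = inner x (z * cj y)"
    by (simp add: inner_cj_left cj_mult)
  finally show ?thesis .
qed

lemma cd_minus_left [simp]: "(- x) * y = - (x * y)"
  for x y :: "'a::cd_algebra"
  using cd_scaleR_left[of "-1" x y] by (simp del: cd_scaleR_left)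

lemma cd_minus_right [simp]: "x * (- y) = - (x * y)"
  for x y :: "'a::cd_algebra"
  using cd_scaleR_right[of x "-1" y] by (simp del: cd_scaleR_right)

lemma cd_zero_left [simp]: "0 * x = 0"
  for x :: "'a::cd_algebra"
  using cd_scaleR_left[of 0 0 x] by (simp del: cd_scaleR_left)

lemma cd_zero_right [simp]: "x * 0 = 0"
  for x :: "'a::cd_algebra"
  using cd_scaleR_right[of x 0 0] by (simp del: cd_scaleR_right)

lemma cd_diff_left: "(x - y) * z = x * z - y * z"
  for x y z :: "'a::cd_algebra"
  using cd_distrib_right[of x "- y" z] by simp

lemma cd_diff_right: "x * (y - z) = x * y - x * z"
  for x y z :: "'a::cd_algebra"
  using cd_distrib_left[of x y "- z"] by simp

lemmas cd_bilinear = cd_distrib_left cd_distrib_right cd_diff_left cd_diff_right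

lemma cj_mult_self: "cj x * x = (inner x x) *\<^sub>R 1"
  for x :: "'a::cd_algebra"
proof -
  \<comment> \<open>\<open>cj x * x\<close> is fixed by the involution, hence real.\<close>
  have "cj (cj x * x) = cj x * x"
    by (simp add: cj_mult)
  then have "2 *\<^sub>R (cj x * x) = 2 *\<^sub>R (inner (cj x * x) 1 *\<^sub>R 1)"
    using add_cj[of "cj x * x"] by (simp add: scaleR_2[symmetric])
  then have "cj x * x = inner (cj x * x) 1 *\<^sub>R 1"
    by (simp only: scaleR_cancel_left) simp
  then show ?thesis
    by (simp add: inner_mult_left_adjoint)
qed

lemma mult_cj_self: "x * cj x = (inner x x) *\<^sub>R 1"
  for x :: "'a::cd_algebra"
  using cj_mult_self[of "cj x"] by simp

instantiation real :: cd_algebra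
begin
instance
  by standard (simp_all add: involution_real_def algebra_simps)
end

instantiation cayley_dickson :: (cd_algebra) cd_algebra
begin

definition one_cayley_dickson_def: "1 = CD 1 0"

instance
proof
  fix x y z :: "'a cayley_dickson" and r :: real
  obtain a b where x: "x = CD a b" by (cases x)
  obtain c d where y: "y = CD c d" by (cases y)
  obtain p q where z: "z = CD p q" by (cases z)
  show "(x + y) * z = x * z + y * z" "x * (y + z) = x * y + x * z"
    by (simp_all add: x y z cd_bilinear)
  show "(r *\<^sub>R x) * y = r *\<^sub>R (x * y)" "x * (r *\<^sub>R y) = r *\<^sub>R (x * y)"
    by (simp_all add: x y algebra_simps)
  show "1 * x = x" "x * 1 = x" "inner (1 :: 'a cayley_dickson) 1 = 1"
    by (simp_all add: x one_cayley_dickson_def)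
  show "x + cj x = (2 * inner x 1) *\<^sub>R 1"
    by (simp add: x one_cayley_dickson_def add_cj)
  show "cj (x * y) = cj y * cj x"
    by (simp add: x y cj_mult)
  \<comment> \<open>Each mixed term needs two steps: the left adjoint and then the right adjoint.\<close>
  have "inner (cj d * b) p = inner d (b * cj p)"
    by (metis inner_commute inner_mult_left_adjoint inner_mult_right_adjoint)
  moreover have "inner (b * cj c) q = inner c (cj q * b)"
    by (metis inner_commute inner_mult_left_adjoint inner_mult_right_adjoint)
  moreover have "inner (a * c) p = inner c (cj a * p)" "inner (d * a) q = inner d (q * cj a)"
    by (rule inner_mult_left_adjoint, rule inner_mult_right_adjoint)
  ultimately show "inner (x * y) z = inner y (cj x * z)"
    by (simp add: x y z inner_diff_left inner_add_left inner_diff_right inner_add_right)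
qed

end

section \<open>The properties lost by doubling\<close>

text \<open>
  Each doubling loses one property: the reals have a trivial involution, the complex numbers are
  still commutative, the quaternions still associative, and the octonions still alternative. The
  classes below record this chain, so that the octonions are an alternative algebra by four instance
  declarations.
\<close>

text \<open>
  Conjugation differs from negation by a real number, so this law, which is also the source of the
  multiplicative norm, is equivalent to the usual left alternative law \<open>x (x y) = (x x) y\<close>.
\<close>

class cd_alternative = cd_algebra +
  assumes cj_mult_mult: "cj x * (x * y) = inner x x *\<^sub>R y"

lemma mult_cj_mult: "x * (cj x * y) = inner x x *\<^sub>R y"
  for x y :: "'a::cd_alternative"
  using cj_mult_mult[of "cj x" y] by simp

lemma mult_mult_cj: "(y * x) * cj x = inner x x *\<^sub>R y"
  for x y :: "'a::cd_alternative"
proof -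
  have "cj ((y * x) * cj x) = cj (inner x x *\<^sub>R y)"
    by (simp add: cj_mult mult_cj_mult)
  then show ?thesis
    by (metis cj_cj)
qed

class cd_associative = cd_algebra +
  assumes cd_assoc: "(x * y) * z = x * (y * z)"

instance cd_associative \<subseteq> cd_alternative
  by standard (simp add: cd_assoc[symmetric] cj_mult_self)

class cd_commutative = cd_associative +
  assumes cd_commute: "x * y = y * x"

lemma cd_left_commute: "x * (y * z) = y * (x * z)"
  for x y z :: "'a::cd_commutative"
  by (metis cd_assoc cd_commute)

class cd_trivial_involution = cd_associative +
  assumes cj_trivial: "cj x = x"
begin
subclass cd_commutative
  by standard (metis cj_mult cj_trivial)
end

instance real :: cd_trivial_involution
  by standard (simp_all add: involution_real_def)

instance cayley_dickson :: (cd_trivial_involution) cd_commutative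
proof
  fix x y z :: "'a cayley_dickson"
  obtain a b where x: "x = CD a b" by (cases x)
  obtain c d where y: "y = CD c d" by (cases y)
  obtain p q where z: "z = CD p q" by (cases z)
  show "x * y = y * x"
    by (simp add: x y cj_trivial cd_commute add.commute)
  show "(x * y) * z = x * (y * z)"
    by (simp add: x y z cj_trivial cd_bilinear cd_assoc cd_commute cd_left_commute algebra_simps)
qed

instance cayley_dickson :: (cd_commutative) cd_associative
proof
  fix x y z :: "'a cayley_dickson"
  obtain a b where x: "x = CD a b" by (cases x)
  obtain c d where y: "y = CD c d" by (cases y)
  obtain p q where z: "z = CD p q" by (cases z)
  show "(x * y) * z = x * (y * z)"
    by (simp add: x y z cd_bilinear cj_mult cd_assoc cd_commute cd_left_commute algebra_simps)
qed

instance cayley_dickson :: (cd_associative) cd_alternative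
proof
  fix x y :: "'a cayley_dickson"
  obtain a b where x: "x = CD a b" by (cases x)
  obtain c d where y: "y = CD c d" by (cases y)
  show "cj x * (x * y) = inner x x *\<^sub>R y"
    by (simp add: x y cd_bilinear cj_mult cd_assoc cj_mult_mult mult_cj_mult cj_mult_self
        mult_cj_self algebra_simps)
qed


section \<open>Norm and associator in alternative algebras\<close>

lemma cd_norm_mult: "norm (x * y) = norm x * norm y"
  for x y :: "'a::cd_alternative"
proof -
  have "inner (x * y) (x * y) = inner x x * inner y y"
    by (simp add: inner_mult_left_adjoint cj_mult_mult)
  then show ?thesis
    by (simp add: norm_eq_sqrt_inner real_sqrt_mult)
qed

lemma imaginary_square_left: "inner x 1 = 0 \<Longrightarrow> x * (x * y) = - (inner x x *\<^sub>R y)"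
  for x y :: "'a::cd_alternative"
  using cj_mult_mult[of x y] by (simp add: cj_imaginary) (metis minus_minus)

lemma imaginary_square_right: "inner x 1 = 0 \<Longrightarrow> (y * x) * x = - (inner x x *\<^sub>R y)"
  for x y :: "'a::cd_alternative"
  using mult_mult_cj[of y x] by (simp add: cj_imaginary) (metis minus_minus)

text \<open>
  Linearising the square rules: left multiplications by orthogonal imaginary elements anticommute,
  and so do right multiplications. These rules replace associativity in what follows.
\<close>

lemma imaginary_swap_left:
  fixes x y z :: "'a::cd_alternative"
  assumes "inner x 1 = 0" "inner y 1 = 0" "inner x y = 0"
  shows "x * (y * z) = - (y * (x * z))"
proof -
  have "(x + y) * ((x + y) * z) = - (inner (x + y) (x + y) *\<^sub>R z)"
    using assms by (intro imaginary_square_left) (simp add: inner_add_left)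
  then show ?thesis
    using assms
    by (simp add: cd_bilinear imaginary_square_left inner_add_left inner_add_right
        inner_commute[of y x] scaleR_add_left eq_neg_iff_add_eq_0 add.commute)
qed

lemma imaginary_swap_right:
  fixes x y z :: "'a::cd_alternative"
  assumes "inner x 1 = 0" "inner y 1 = 0" "inner x y = 0"
  shows "(z * x) * y = - ((z * y) * x)"
proof -
  have "(z * (x + y)) * (x + y) = - (inner (x + y) (x + y) *\<^sub>R z)"
    using assms by (intro imaginary_square_right) (simp add: inner_add_left)
  then show ?thesis
    using assms
    by (simp add: cd_bilinear imaginary_square_right inner_add_left inner_add_right
        inner_commute[of y x] scaleR_add_left eq_neg_iff_add_eq_0 add.commute)
qed

lemma imaginary_anticommute:
  fixes x y :: "'a::cd_alternative"
  assumes "inner x 1 = 0" "inner y 1 = 0" "inner x y = 0"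
  shows "x * y = - (y * x)"
  using imaginary_swap_left[OF assms, of 1] by simp

definition associator :: "'a::cd_algebra \<Rightarrow> 'a \<Rightarrow> 'a \<Rightarrow> 'a" where
  "associator x y z = (x * y) * z - x * (y * z)"

lemma associator_linear:
  "associator (x + r *\<^sub>R w) y z = associator x y z + r *\<^sub>R associator w y z"
  "associator x (y + r *\<^sub>R w) z = associator x y z + r *\<^sub>R associator x w z"
  "associator x y (z + r *\<^sub>R w) = associator x y z + r *\<^sub>R associator x y w"
  by (simp_all add: associator_def cd_bilinear algebra_simps)

lemma associator_one [simp]:
  "associator 1 y z = 0" "associator x 1 z = 0" "associator x y 1 = 0"
  by (simp_all add: associator_def)

lemma associator_left [simp]: "associator x x y = 0"
  for x y :: "'a::cd_alternative"
proof -
  \<comment> \<open>The multiple of \<open>1\<close> contributes nothing to the associator.\<close>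
  have x: "x = (2 * inner x 1) *\<^sub>R 1 - cj x"
    by (simp add: cj_eq)
  have "associator (cj x) x y = 0"
    by (simp add: associator_def cj_mult_mult cj_mult_self)
  then have "associator ((2 * inner x 1) *\<^sub>R 1 - cj x) x y = 0"
    by (simp add: associator_def cd_bilinear)
  then show ?thesis
    by (simp add: x[symmetric])
qed

lemma associator_right [simp]: "associator y x x = 0"
  for x y :: "'a::cd_alternative"
proof -
  have x: "x = (2 * inner x 1) *\<^sub>R 1 - cj x"
    by (simp add: cj_eq)
  have "associator y x (cj x) = 0"
    by (simp add: associator_def mult_mult_cj mult_cj_self)
  then have "associator y x ((2 * inner x 1) *\<^sub>R 1 - cj x) = 0"
    by (simp add: associator_def cd_bilinear)
  then show ?thesis
    by (simp add: x[symmetric])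
qed

text \<open>Vanishing on \<open>(x, x, y)\<close> and \<open>(y, x, x)\<close>, the associator is alternating.\<close>

lemma associator_flexible [simp]: "associator x y x = 0"
  for x y :: "'a::cd_alternative"
  using associator_left[of "x + y" x] associator_linear(1)[of x 1 y "x + y" x]
    associator_linear(2)[of x x 1 y x] associator_linear(2)[of y x 1 y x]
  by simp

lemma norm_associator_le: "norm (associator x y z) \<le> 2 * (norm x * norm y * norm z)"
  for x y z :: "'a::cd_alternative"
  using norm_triangle_ineq4[of "(x * y) * z" "x * (y * z)"]
  by (simp add: associator_def cd_norm_mult)

lemma orthogonal_if_norm_minimal:
  fixes x y :: "'a::real_inner"
  assumes "\<And>t. norm x \<le> norm (x + t *\<^sub>R y)"
  shows "inner x y = 0"
proof (cases "y = 0")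
  case False
  \<comment> \<open>The foot of the perpendicular from the origin to the line through \<open>x\<close> with direction \<open>y\<close>.\<close>
  define t where "t = - inner x y / inner y y"
  have "inner x x \<le> inner (x + t *\<^sub>R y) (x + t *\<^sub>R y)"
    using assms[of t] by (simp add: norm_eq_sqrt_inner)
  also have "\<dots> = inner x x - (inner x y)\<^sup>2 / inner y y"
  proof -
    have "inner (x + t *\<^sub>R y) (x + t *\<^sub>R y) = inner x x + 2 * t * inner x y + t\<^sup>2 * inner y y"
      by (simp add: inner_add_left inner_add_right inner_commute[of y x] power2_eq_square
          algebra_simps)
    then show ?thesis
      using False by (simp add: t_def field_simps power2_eq_square)
  qed
  finally have "(inner x y)\<^sup>2 / inner y y \<le> 0"
    by simp
  moreover have "inner y y > 0"
    using False by simp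
  ultimately have "(inner x y)\<^sup>2 \<le> 0"
    by (simp add: divide_le_0_iff)
  then show ?thesis
    by simp
qed simp

text \<open>
  For such a triple the bound in \<open>norm_associator_le\<close> is an equality. If an entry is moved by a
  multiple of some \<open>w\<close> on which the associator with the other two entries vanishes, then the
  associator stays the same, so the bound forbids the entry to become shorter, and it is orthogonal
  to \<open>w\<close>. Both \<open>1\<close> and the other two entries may be taken for \<open>w\<close>.
\<close>

lemma antiassociative_imp_imaginary_orthogonal:
  fixes x y z :: "'a::cd_alternative"
  assumes anti: "(x * y) * z = - (x * (y * z))" and nz: "x \<noteq> 0" "y \<noteq> 0" "z \<noteq> 0"
  shows "inner x 1 = 0" "inner y 1 = 0" "inner z 1 = 0"
    "inner x y = 0" "inner x z = 0" "inner y z = 0"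
proof -
  have "associator x y z = 2 *\<^sub>R ((x * y) * z)"
    using anti by (simp add: associator_def scaleR_2)
  then have max: "norm (associator x y z) = 2 * (norm x * norm y * norm z)"
    by (simp add: cd_norm_mult)
  have x_orth: "inner x w = 0" if "associator w y z = 0" for w
  proof (rule orthogonal_if_norm_minimal)
    fix t
    have "associator (x + t *\<^sub>R w) y z = associator x y z"
      using that by (simp add: associator_linear)
    then show "norm x \<le> norm (x + t *\<^sub>R w)"
      using norm_associator_le[of "x + t *\<^sub>R w" y z] max nz by simp
  qed
  have y_orth: "inner y w = 0" if "associator x w z = 0" for w
  proof (rule orthogonal_if_norm_minimal)
    fix t
    have "associator x (y + t *\<^sub>R w) z = associator x y z"
      using that by (simp add: associator_linear)
    then show "norm y \<le> norm (y + t *\<^sub>R w)"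
      using norm_associator_le[of x "y + t *\<^sub>R w" z] max nz by simp
  qed
  have z_orth: "inner z w = 0" if "associator x y w = 0" for w
  proof (rule orthogonal_if_norm_minimal)
    fix t
    have "associator x y (z + t *\<^sub>R w) = associator x y z"
      using that by (simp add: associator_linear)
    then show "norm z \<le> norm (z + t *\<^sub>R w)"
      using norm_associator_le[of x y "z + t *\<^sub>R w"] max nz by simp
  qed
  show "inner x 1 = 0" "inner y 1 = 0" "inner z 1 = 0"
    "inner x y = 0" "inner x z = 0" "inner y z = 0"
    by (simp_all add: x_orth y_orth z_orth)
qed

section \<open>Zero divisors\<close>

text \<open>
  The zero divisors of the doubled algebra, as it will turn out, when its base is alternative of
  dimension at least 7.
\<close>

definition pure_pair :: "'a::cd_algebra cayley_dickson \<Rightarrow> bool" where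
  "pure_pair u \<longleftrightarrow> u \<noteq> 0 \<and> inner (cd_fst u) 1 = 0 \<and> inner (cd_snd u) 1 = 0 \<and>
     inner (cd_fst u) (cd_snd u) = 0 \<and> norm (cd_fst u) = norm (cd_snd u)"

text \<open>
  For a pure pair \<open>(a, b)\<close> over an alternative algebra this is the unit imaginary \<open>k\<close> with \<open>b = - a * k\<close>.
\<close>

definition pair_axis :: "'a::cd_algebra cayley_dickson \<Rightarrow> 'a" where
  "pair_axis u = (cd_fst u * cd_snd u) /\<^sub>R (norm (cd_fst u))\<^sup>2"

lemma vector_eq_minus_self_iff: "x = - x \<longleftrightarrow> x = 0"
  for x :: "'a::real_vector"
  by (simp add: eq_neg_iff_add_eq_0 flip: scaleR_2)

lemma pure_pair_CD:
  "pure_pair (CD a b) \<longleftrightarrow> a \<noteq> 0 \<and> b \<noteq> 0 \<and> inner a 1 = 0 \<and> inner b 1 = 0 \<and> inner a b = 0 \<and>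
     norm a = norm b"
  by (auto simp: pure_pair_def)

lemma pure_pair_cj [simp]: "pure_pair (cj u) \<longleftrightarrow> pure_pair u"
  by (cases u) (auto simp: pure_pair_CD cj_imaginary inner_cj_left)

lemma pure_pair_cj_eq: "pure_pair u \<Longrightarrow> cj u = - u"
  by (cases u) (simp add: pure_pair_CD cj_imaginary)

lemma cj_eq_0_iff [simp]: "cj x = 0 \<longleftrightarrow> x = 0" for x :: "'a::cd_algebra"
  by (metis cj_cj cj_zero)

text \<open>
  Eliminating \<open>d\<close> from the two component equations leaves the antiassociative triple \<open>a, c, cj b\<close>.
  Statements about \<open>d\<close> follow by conjugating the product or exchanging its factors.
\<close>

lemma zero_product_components:
  fixes a b c d :: "'a::cd_alternative"
  assumes uv: "CD a b * CD c d = 0" and u: "CD a b \<noteq> 0" and v: "CD c d \<noteq> 0"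
  shows "pure_pair (CD a b)" "inner c 1 = 0" "inner a c = 0" "inner b c = 0"
proof -
  have 1: "a * c = cj d * b" and 2: "d * a = - (b * cj c)"
    using uv by (simp_all add: eq_neg_iff_add_eq_0)
  have "norm a * norm c = norm d * norm b" "norm d * norm a = norm b * norm c"
    using arg_cong[OF 1, of norm] arg_cong[OF 2, of norm] by (simp_all add: cd_norm_mult)
  \<comment> \<open>The sum and the difference of these two equations factor.\<close>
  then have "(norm a - norm b) * (norm c + norm d) = 0" "(norm c - norm d) * (norm a + norm b) = 0"
    by (simp_all add: algebra_simps)
  moreover have "norm c + norm d \<noteq> 0" "norm a + norm b \<noteq> 0"
    using u v by (auto simp: add_nonneg_eq_0_iff)
  ultimately have norms: "norm a = norm b" "norm c = norm d"
    by simp_all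
  then have nz: "a \<noteq> 0" "b \<noteq> 0" "c \<noteq> 0" "d \<noteq> 0"
    using u v by auto
  have N: "inner b b = inner a a"
    using norms by (simp add: norm_eq_sqrt_inner)
  \<comment> \<open>Both bracketings of \<open>a, c, cj b\<close> are multiples of \<open>cj d\<close>, with opposite signs.\<close>
  have "(a * c) * cj b = inner a a *\<^sub>R cj d"
    by (simp add: 1 mult_mult_cj N)
  moreover have "cj a * cj d = - (c * cj b)"
    using arg_cong[OF 2, of cj] by (simp add: cj_mult)
  then have "a * (c * cj b) = - (a * (cj a * cj d))"
    by simp
  then have "a * (c * cj b) = - (inner a a *\<^sub>R cj d)"
    by (simp add: mult_cj_mult)
  ultimately have "(a * c) * cj b = - (a * (c * cj b))"
    by simp
  note anti = antiassociative_imp_imaginary_orthogonal[OF this nz(1) nz(3)]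
  have b: "inner b 1 = 0"
    using anti nz by (simp add: inner_cj_left)
  then have "cj b = - b"
    by (rule cj_imaginary)
  then show "pure_pair (CD a b)" "inner c 1 = 0" "inner a c = 0" "inner b c = 0"
    using anti nz norms b by (simp_all add: pure_pair_CD inner_commute)
qed

lemma zero_product_imp_pure_pair:
  fixes u v :: "'a::cd_alternative cayley_dickson"
  assumes "u * v = 0" "u \<noteq> 0" "v \<noteq> 0"
  shows "pure_pair u" "pure_pair v"
proof -
  show "pure_pair u"
    using assms by (cases u, cases v) (metis zero_product_components(1))
  have "cj v * cj u = 0"
    using assms(1) by (simp flip: cj_mult)
  moreover have "cj u \<noteq> 0" "cj v \<noteq> 0"
    using assms by simp_all
  ultimately have "pure_pair (cj v)"
    by (cases "cj v", cases "cj u") (metis zero_product_components(1))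
  then show "pure_pair v"
    by simp
qed

text \<open>The involution reverses products and acts as negation on pure pairs.\<close>

lemma zero_product_commute:
  fixes u v :: "'a::cd_alternative cayley_dickson"
  assumes "u * v = 0"
  shows "v * u = 0"
proof (cases "u = 0 \<or> v = 0")
  case False
  then have "cj u = - u" "cj v = - v"
    using zero_product_imp_pure_pair[OF assms] by (simp_all add: pure_pair_cj_eq)
  then show ?thesis
    using cj_mult[of u v] assms by simp
qed auto

text \<open>
  For imaginary entries \<open>u * v = 0\<close> means \<open>a c = - d b\<close> and \<open>d a = b c\<close>. Either equation determines \<open>d\<close>,
  and the swap rules identify the result as \<open>c (a b) / \<bar>a\<bar>\<^sup>2\<close>, which is the \<open>d\<close> that gives \<open>(c, d)\<close> the
  axis opposite to that of \<open>(a, b)\<close>.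
\<close>

lemma zero_product_iff:
  fixes u v :: "'a::cd_alternative cayley_dickson"
  assumes "pure_pair u" "pure_pair v"
  shows "u * v = 0 \<longleftrightarrow> pair_axis v = - pair_axis u \<and>
    inner (cd_fst u) (cd_fst v) = 0 \<and> inner (cd_snd u) (cd_fst v) = 0"
proof -
  obtain a b c d where u: "u = CD a b" and v: "v = CD c d"
    by (metis cayley_dickson.exhaust)
  define N M where "N = inner a a" and "M = inner c c"
  have pu: "a \<noteq> 0" "b \<noteq> 0" "inner a 1 = 0" "inner b 1 = 0" "inner a b = 0" "inner b b = N"
   and pv: "c \<noteq> 0" "d \<noteq> 0" "inner c 1 = 0" "inner d 1 = 0" "inner c d = 0" "inner d d = M"
    using assms by (auto simp: u v pure_pair_CD N_def M_def norm_eq_sqrt_inner)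
  have NM: "N \<noteq> 0" "M \<noteq> 0"
    using pu pv by (simp_all add: N_def M_def)
  have axis: "pair_axis v = - pair_axis u \<longleftrightarrow> N *\<^sub>R (c * d) = - (M *\<^sub>R (a * b))"
  proof -
    have "(N * M) *\<^sub>R pair_axis v = N *\<^sub>R (c * d)" "(N * M) *\<^sub>R pair_axis u = M *\<^sub>R (a * b)"
      using NM by (simp_all add: pair_axis_def u v power2_norm_eq_inner flip: N_def M_def)
    moreover have "pair_axis v = - pair_axis u \<longleftrightarrow> (N * M) *\<^sub>R pair_axis v = - ((N * M) *\<^sub>R pair_axis u)"
      using NM by (simp flip: scaleR_minus_right)
    ultimately show ?thesis
      by simp
  qed
  have zero: "u * v = 0 \<longleftrightarrow> a * c = - (d * b) \<and> d * a = b * c"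
    using pv by (simp add: u v cj_imaginary eq_neg_iff_add_eq_0)
  show ?thesis
  proof
    assume uv: "u * v = 0"
    then have orth: "inner a c = 0" "inner b c = 0"
      using zero_product_components[of a b c d] pu pv by (auto simp: u v)
    have eqs: "a * c = - (d * b)" "d * a = b * c"
      using uv zero by simp_all
    have "v * u = 0"
      using uv by (rule zero_product_commute)
    then have "inner d a = 0"
      using zero_product_components(4)[of c d a b] pu pv by (auto simp: u v)
    then have "N *\<^sub>R d = a * (d * a)"
      using imaginary_anticommute[of d a] imaginary_square_left[of a d] pu pv by (simp add: N_def)
    also have "\<dots> = c * (a * b)"
      using imaginary_anticommute[of b c] imaginary_swap_left[of a c b] pu pv orth
      by (simp add: eqs)
    finally have "c * (N *\<^sub>R d) = c * (c * (a * b))"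
      by simp
    then have "N *\<^sub>R (c * d) = - (M *\<^sub>R (a * b))"
      using imaginary_square_left[of c "a * b"] pv by (simp add: M_def)
    with orth show "pair_axis v = - pair_axis u \<and> inner (cd_fst u) (cd_fst v) = 0 \<and>
        inner (cd_snd u) (cd_fst v) = 0"
      by (simp add: axis) (simp add: u v)
  next
    assume "pair_axis v = - pair_axis u \<and> inner (cd_fst u) (cd_fst v) = 0 \<and>
      inner (cd_snd u) (cd_fst v) = 0"
    then have ax: "N *\<^sub>R (c * d) = - (M *\<^sub>R (a * b))"
      and orth: "inner a c = 0" "inner b c = 0"
      by (simp_all add: axis) (simp_all add: u v)
    \<comment> \<open>Solve the condition on the axes for \<open>d\<close>.\<close>
    have "M *\<^sub>R (c * (a * b)) = M *\<^sub>R (N *\<^sub>R d)"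
    proof -
      have "c * (N *\<^sub>R (c * d)) = c * (- (M *\<^sub>R (a * b)))"
        by (simp only: ax)
      then show ?thesis
        using pv by (simp add: imaginary_square_left M_def mult.commute)
    qed
    then have Nd: "N *\<^sub>R d = c * (a * b)"
      using NM by (simp only: scaleR_cancel_left) auto
    have ab: "inner (a * b) 1 = 0"
      using pu by (simp add: inner_mult_left_adjoint cj_imaginary inner_commute[of b a])
    \<comment> \<open>\<open>c\<close> is orthogonal to \<open>a * b\<close>, because \<open>a * b\<close> is a multiple of \<open>c * d\<close>.\<close>
    have "M * inner (a * b) c = inner (- (M *\<^sub>R (a * b))) (- c)"
      by simp
    also have "\<dots> = inner (N *\<^sub>R (c * d)) (- c)"
      by (simp only: ax)
    also have "\<dots> = 0"
      using pv by (simp add: inner_mult_left_adjoint cj_mult_self)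
    finally have "inner (a * b) c = 0"
      using NM by simp
    then have "c * (a * b) = - ((a * b) * c)"
      using imaginary_anticommute[of "a * b" c] ab pv by simp
    also have "\<dots> = (a * c) * b"
      using imaginary_swap_right[of b c a] pu pv orth by simp
    finally have Nd': "N *\<^sub>R d = (a * c) * b"
      using Nd by simp
    have "N *\<^sub>R (d * b) = N *\<^sub>R (- (a * c))"
    proof -
      have "(N *\<^sub>R d) * b = - (N *\<^sub>R (a * c))"
        using imaginary_square_right[of b "a * c"] pu by (simp only: Nd')
      then show ?thesis
        by simp
    qed
    moreover have "N *\<^sub>R (d * a) = N *\<^sub>R (b * c)"
    proof -
      have "(N *\<^sub>R d) * a = - (((c * a) * b) * a)"
        using imaginary_anticommute[of a c] pu pv orth by (simp add: Nd')
      also have "\<dots> = ((c * a) * a) * b"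
        using imaginary_swap_right[of b a "c * a"] pu by (simp add: inner_commute)
      also have "\<dots> = - (N *\<^sub>R (c * b))"
        using imaginary_square_right[of a c] pu by (simp add: N_def)
      also have "\<dots> = N *\<^sub>R (b * c)"
        using imaginary_anticommute[of b c] pu pv orth by simp
      finally show ?thesis
        by simp
    qed
    ultimately have "d * b = - (a * c)" "d * a = b * c"
      using NM by (simp_all only: scaleR_cancel_left) auto
    then show "u * v = 0"
      by (simp add: zero)
  qed
qed

text \<open>
  The six elements \<open>1, k, a, b, c, d\<close> do not span a space of dimension at least 7. Any nonzero \<open>x\<close>
  orthogonal to them is the first entry of a pure pair with axis \<open>- k\<close>, whose second entry is \<open>x * k\<close>
  because \<open>x * (x * k) = - (inner x x *\<^sub>R k)\<close>.
\<close>

lemma exists_orthogonal_pure_pair: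
  fixes a b c d k :: "'a::cd_alternative"
  assumes dim: "DIM('a) \<ge> 7" and k: "inner k 1 = 0" "norm k = 1"
  obtains w where "pure_pair w" "pair_axis w = - k"
    "inner a (cd_fst w) = 0" "inner b (cd_fst w) = 0"
    "inner c (cd_fst w) = 0" "inner d (cd_fst w) = 0"
proof -
  have "dim {1, k, a, b, c, d} \<le> card {1, k, a, b, c, d}"
    by (intro dim_le_card') simp
  also have "\<dots> \<le> 6"
    by (intro card_insert_le_m1) simp_all
  finally have "dim {1, k, a, b, c, d} < DIM('a)"
    using dim by simp
  then obtain x where x: "x \<noteq> 0" "\<And>y. y \<in> span {1, k, a, b, c, d} \<Longrightarrow> orthogonal x y"
    by (metis orthogonal_to_subspace_exists)
  have orth: "inner x 1 = 0" "inner x k = 0" "inner x a = 0" "inner x b = 0" "inner x c = 0"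
    "inner x d = 0"
    using x(2)[OF span_base] by (auto simp: orthogonal_def)
  have "inner (x * k) 1 = 0"
    using orth by (simp add: inner_mult_left_adjoint cj_imaginary inner_commute[of k x])
  moreover have "inner x (x * k) = 0"
    using orth k
    by (simp add: inner_commute[of x "x * k"] inner_commute[of k] inner_mult_left_adjoint
        cj_mult_self)
  moreover have "norm (x * k) = norm x"
    by (simp add: cd_norm_mult k)
  moreover have "x * k \<noteq> 0"
    using calculation x(1) by auto
  ultimately have "pure_pair (CD x (x * k))"
    using x orth by (simp add: pure_pair_CD)
  moreover have "pair_axis (CD x (x * k)) = - k"
    using x orth by (simp add: pair_axis_def imaginary_square_left power2_norm_eq_inner)
  ultimately show thesis
    using that[of "CD x (x * k)"] orth by (simp add: inner_commute)
qed

lemma axis_imaginary: "pure_pair u \<Longrightarrow> inner (pair_axis u) 1 = 0"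
  by (cases u)
    (auto simp: pure_pair_CD pair_axis_def inner_mult_left_adjoint cj_imaginary
      intro: inner_commute[THEN trans])

lemma norm_axis: "pure_pair u \<Longrightarrow> norm (pair_axis u) = 1"
  for u :: "'a::cd_alternative cayley_dickson"
  by (cases u) (auto simp: pure_pair_CD pair_axis_def cd_norm_mult field_simps power2_eq_square)

lemma axis_neq_minus_axis: "pure_pair u \<Longrightarrow> pair_axis u \<noteq> - pair_axis u"
  for u :: "'a::cd_alternative cayley_dickson"
  using norm_axis[of u] by (auto simp: vector_eq_minus_self_iff)

lemma common_neighbour:
  fixes u v :: "'a::cd_alternative cayley_dickson"
  assumes "DIM('a) \<ge> 7" "pure_pair u" "pure_pair v" "pair_axis u = pair_axis v"
  obtains w where "pure_pair w" "u * w = 0" "w * v = 0" "pair_axis w = - pair_axis u"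
proof -
  obtain w where w: "pure_pair w" "pair_axis w = - pair_axis u"
    "inner (cd_fst u) (cd_fst w) = 0" "inner (cd_snd u) (cd_fst w) = 0"
    "inner (cd_fst v) (cd_fst w) = 0" "inner (cd_snd v) (cd_fst w) = 0"
    using exists_orthogonal_pure_pair[OF assms(1) axis_imaginary norm_axis] assms(2) by metis
  then have "u * w = 0" "v * w = 0"
    using assms by (simp_all add: zero_product_iff)
  then show thesis
    using that w zero_product_commute by blast
qed


section \<open>The orthogonality graph\<close>

lemma sedenion_zero_divisors_eq: "sedenion_zero_divisors = {u. pure_pair u}"
proof (intro equalityI subsetI)
  fix u assume "u \<in> sedenion_zero_divisors"
  then show "u \<in> {u. pure_pair u}"
    by (auto simp: sedenion_zero_divisors_def dest: zero_product_imp_pure_pair)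
next
  fix u :: sedenion assume "u \<in> {u. pure_pair u}"
  then obtain w where "pure_pair w" "u * w = 0"
    using common_neighbour[of u u] by auto
  with \<open>u \<in> _\<close> show "u \<in> sedenion_zero_divisors"
    by (auto simp: sedenion_zero_divisors_def pure_pair_def)
qed

lemma span_singleton_eqD:
  fixes u v :: "'a::real_vector"
  assumes "span {u} = span {v}"
  obtains r where "u = r *\<^sub>R v"
  using span_base[of u "{u}"] assms by (auto simp: span_singleton)

text \<open>Adjacency can be tested on any representatives of the two lines.\<close>

lemma arc_iff:
  assumes "pure_pair u" "pure_pair v"
  shows "(span {u}, span {v}) \<in> parcs sedenion_orthogonality_graph \<longleftrightarrow> u * v = 0"
proof
  assume "(span {u}, span {v}) \<in> parcs sedenion_orthogonality_graph"
  then obtain u' v' :: sedenion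
    where *: "span {u} = span {u'}" "span {v} = span {v'}" "u' * v' = 0"
    by (auto simp: sedenion_orthogonality_graph_def)
  obtain r s where "u = r *\<^sub>R u'" "v = s *\<^sub>R v'"
    using * by (metis span_singleton_eqD)
  with * show "u * v = 0"
    by simp
next
  assume uv: "u * v = 0"
  have "span {u} \<noteq> span {v}"
  proof
    assume "span {u} = span {v}"
    then obtain r where "u = r *\<^sub>R v"
      by (rule span_singleton_eqD)
    with uv have "u * u = 0"
      by (metis cd_scaleR_right scaleR_zero_right)
    with assms show False
      by (simp add: zero_product_iff axis_neq_minus_axis)
  qed
  with uv zero_product_commute[OF uv] assms
  show "(span {u}, span {v}) \<in> parcs sedenion_orthogonality_graph"
    by (auto simp: sedenion_orthogonality_graph_def sedenion_zero_divisors_eq)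
qed

lemma path_of_opposite_axis:
  fixes u v :: sedenion
  assumes "pure_pair u" "pure_pair v" "pair_axis v = - pair_axis u"
  obtains w w' where "pure_pair w" "pure_pair w'" "u * w = 0" "w * w' = 0" "w' * v = 0"
proof -
  obtain w' where w': "pure_pair w'" "w' * v = 0" "pair_axis w' = - pair_axis v"
    using common_neighbour[of v v] assms by auto
  then obtain w where "pure_pair w" "u * w = 0" "w * w' = 0"
    using common_neighbour[of u w'] assms by auto
  with w' that show thesis
    by blast
qed

lemma (in wf_digraph) graph_distance_le_length:
  assumes "awalk u p v"
  shows "graph_distance G u v \<le> length p"
proof -
  have "awalk_cost (\<lambda>_. 1) p = length p"
    by (induction p) auto
  then show ?thesis
    using min_cost_le_walk_cost[OF assms, of "\<lambda>_. 1"] by (simp add: graph_distance_def)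
qed

lemma (in wf_digraph) graph_distance_geI:
  assumes "\<And>p. awalk u p v \<Longrightarrow> n \<le> length p"
  shows "n \<le> graph_distance G u v"
proof -
  have "awalk_cost (\<lambda>_. 1) p = length p" for p
    by (induction p) auto
  then show ?thesis
    using assms by (auto simp: graph_distance_def \<mu>_def intro!: INF_greatest)
qed

section \<open>The components\<close>

locale orthogonality_component =
  fixes C :: "(sedenion set, sedenion set \<times> sedenion set) pre_digraph"
  assumes component: "C \<in> connected_components sedenion_orthogonality_graph"
begin

sublocale graph: pair_bidirected_digraph sedenion_orthogonality_graph
  by (rule pair_bidirected_digraph_sedenion_orthogonality_graph)

lemma induced: "induced_subgraph C (with_proj sedenion_orthogonality_graph)"
  using component by (auto simp: connected_components_def graph.sccs_def)

sublocale C: wf_digraph C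
  using induced by (rule wf_digraphI_induced)

lemma tail_C [simp]: "tail C = fst" and head_C [simp]: "head C = snd"
  using induced by (auto simp: induced_subgraph_def subgraph_def compatible_def)

lemma arcs_C: "arcs C = {e \<in> parcs sedenion_orthogonality_graph. fst e \<in> verts C \<and> snd e \<in> verts C}"
  using induced by (auto simp: induced_subgraph_def)

lemma vert_representative:
  assumes "X \<in> verts C"
  obtains u where "X = span {u}" "pure_pair u"
proof -
  have "X \<in> pverts sedenion_orthogonality_graph"
    using assms induced by (auto simp: induced_subgraph_def subgraph_def)
  then show thesis
    using that by (auto simp: sedenion_orthogonality_graph_def sedenion_zero_divisors_eq)
qed

lemma neighbour_in_component:
  assumes "span {u} \<in> verts C" "pure_pair u" "pure_pair v" "u * v = 0"
  shows "span {v} \<in> verts C" "(span {u}, span {v}) \<in> arcs C"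
proof -
  have arcs: "(span {u}, span {v}) \<in> parcs sedenion_orthogonality_graph"
    "(span {v}, span {u}) \<in> parcs sedenion_orthogonality_graph"
    using assms zero_product_commute by (auto simp: arc_iff)
  then have "span {u} \<rightarrow>\<^sup>*\<^bsub>with_proj sedenion_orthogonality_graph\<^esub> span {v}"
    "span {v} \<rightarrow>\<^sup>*\<^bsub>with_proj sedenion_orthogonality_graph\<^esub> span {u}"
    by (simp_all add: graph.reachable_adjI)
  moreover have "verts C \<in> graph.sccs_verts"
    using component graph.sccs_verts_conv by (auto simp: connected_components_def)
  ultimately show "span {v} \<in> verts C"
    using assms(1) by (auto simp: graph.in_sccs_verts_conv_reachable)
  with arcs assms(1) show "(span {u}, span {v}) \<in> arcs C"
    by (simp add: arcs_C)
qed

text \<open>By \<open>zero_product_iff\<close> every arc reverses the axis.\<close>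

lemma axis_along_walk:
  assumes "C.awalk (span {u}) p Y" "pure_pair u"
  shows "\<exists>v. Y = span {v} \<and> pure_pair v \<and> (pair_axis v = pair_axis u \<or> pair_axis v = - pair_axis u)"
  using assms
proof (induction p arbitrary: u)
  case Nil
  then show ?case
    by (auto simp: C.awalk_Nil_iff)
next
  case (Cons e p)
  then have e: "e \<in> arcs C" "fst e = span {u}" "C.awalk (snd e) p Y"
    by (auto simp: C.awalk_Cons_iff)
  then obtain w where w: "snd e = span {w}" "pure_pair w"
    using vert_representative by (auto simp: arcs_C)
  then have "u * w = 0"
    using e Cons.prems arc_iff[of u w] by (cases e) (auto simp: arcs_C)
  then have "pair_axis w = - pair_axis u"
    using zero_product_iff w Cons.prems by blast
  then show ?case
    using Cons.IH[of w] w e by auto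
qed

lemma component_representative:
  assumes "span {u} \<in> verts C" "pure_pair u" "Y \<in> verts C"
  obtains v where "Y = span {v}" "pure_pair v" "pair_axis v = pair_axis u \<or> pair_axis v = - pair_axis u"
proof -
  have "strongly_connected C"
    using component by (auto simp: connected_components_def graph.sccs_def)
  then have "span {u} \<rightarrow>\<^sup>*\<^bsub>C\<^esub> Y"
    using assms by auto
  then obtain p where "C.awalk (span {u}) p Y"
    by (auto simp: C.reachable_awalk)
  then show thesis
    using axis_along_walk assms that by blast
qed

lemma walk_of_opposite_axis:
  assumes "span {u} \<in> verts C" "pure_pair u" "pure_pair v" "pair_axis v = - pair_axis u"
  obtains p where "C.awalk (span {u}) p (span {v})" "length p = 3"
proof -
  obtain w w' where "pure_pair w" "pure_pair w'" "u * w = 0" "w * w' = 0" "w' * v = 0"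
    using path_of_opposite_axis assms by metis
  then have "C.awalk (span {u})
      [(span {u}, span {w}), (span {w}, span {w'}), (span {w'}, span {v})] (span {v})"
    using assms neighbour_in_component[of u w] neighbour_in_component[of w w']
      neighbour_in_component[of w' v]
    by (simp add: C.awalk_simps)
  then show thesis
    by (rule that) simp
qed

lemma distance_le_3:
  assumes "X \<in> verts C" "Y \<in> verts C"
  shows "graph_distance C X Y \<le> 3"
proof -
  obtain u where u: "X = span {u}" "pure_pair u"
    using assms vert_representative by blast
  obtain v where v: "Y = span {v}" "pure_pair v" and "pair_axis v = pair_axis u \<or> pair_axis v = - pair_axis u"
    using component_representative u assms by blast
  from this(3) obtain p where "C.awalk X p Y" "length p \<le> 3"
  proof
    assume "pair_axis v = pair_axis u"
    then obtain w where "pure_pair w" "u * w = 0" "w * v = 0"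
      using common_neighbour[of u v] u v by auto
    then have "C.awalk X [(X, span {w}), (span {w}, Y)] Y"
      using assms u v neighbour_in_component by (simp add: C.awalk_simps)
    then show thesis
      by (rule that) simp
  next
    assume "pair_axis v = - pair_axis u"
    then show thesis
      using walk_of_opposite_axis[of u v] that u v assms by (metis order_refl)
  qed
  then show ?thesis
    using C.graph_distance_le_length[of X p Y] by (simp add: order.trans)
qed

text \<open>
  Replacing \<open>b\<close> by \<open>- b\<close> reverses the axis. A walk of length 2 would reverse it twice, and a walk of
  length 1 would make \<open>a\<close> orthogonal to itself.
\<close>

lemma conjugate_at_distance_3:
  assumes u: "span {u} \<in> verts C" "pure_pair u" "u = CD a b"
  defines "v \<equiv> CD a (- b)"
  shows "span {v} \<in> verts C" "3 \<le> graph_distance C (span {u}) (span {v})"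
proof -
  have v: "pure_pair v" "pair_axis v = - pair_axis u" and nz: "a \<noteq> 0" "b \<noteq> 0"
    using u by (auto simp: v_def pure_pair_CD pair_axis_def)
  then show "span {v} \<in> verts C"
    using walk_of_opposite_axis u C.awalk_last_in_verts by metis
  have arc: "x * y = 0" if "(span {x}, span {y}) \<in> arcs C" "pure_pair x" "pure_pair y" for x y
    using that by (simp add: arcs_C arc_iff)
  have "3 \<le> length p" if p: "C.awalk (span {u}) p (span {v})" for p
  proof (rule ccontr)
    assume "\<not> 3 \<le> length p"
    then consider "p = []" | e where "p = [e]" | e f where "p = [e, f]"
      by (cases p; cases "tl p"; cases "tl (tl p)") auto
    then show False
    proof cases
      case 1
      then have "span {u} = span {v}"
        using p by (simp add: C.awalk_Nil_iff)
      then obtain r where "u = r *\<^sub>R v"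
        by (rule span_singleton_eqD)
      then have "a = r *\<^sub>R a" "b = r *\<^sub>R (- b)"
        using u by (simp_all add: v_def)
      then show False
        using nz by (metis scaleR_cancel_right scaleR_one vector_eq_minus_self_iff)
    next
      case 2
      then have "u * v = 0"
        using p u v by (intro arc) (cases e, auto simp: C.awalk_simps)
      then have "inner a a = 0"
        using u v by (simp add: zero_product_iff) (simp add: v_def)
      with nz show False
        by simp
    next
      case 3
      then have ef: "e \<in> arcs C" "f \<in> arcs C" "fst e = span {u}" "fst f = snd e" "snd f = span {v}"
        using p by (auto simp: C.awalk_simps)
      then have "snd e \<in> verts C"
        by (simp add: arcs_C)
      then obtain w where w: "snd e = span {w}" "pure_pair w"
        by (rule vert_representative)
      have "u * w = 0" "w * v = 0"
        using arc[of u w] arc[of w v] ef w u v by (metis prod.collapse)+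
      then have "pair_axis w = - pair_axis u" "pair_axis v = - pair_axis w"
        using zero_product_iff u v w by blast+
      then show False
        using v axis_neq_minus_axis[OF u(2)] by simp
    qed
  qed
  then show "3 \<le> graph_distance C (span {u}) (span {v})"
    using C.graph_distance_geI[of "span {u}" "span {v}" 3] by simp
qed

lemma diameter_eq_3: "graph_diameter C = 3"
proof (rule antisym)
  show "graph_diameter C \<le> 3"
    unfolding graph_diameter_def by (intro SUP_least distance_le_3)
  have "verts C \<noteq> {}"
    using component by (auto simp: connected_components_def graph.sccs_def strongly_connected_def)
  then obtain u where u: "span {u} \<in> verts C" "pure_pair u"
    using vert_representative by blast
  obtain a b where ab: "u = CD a b"
    by (cases u)
  have "3 \<le> graph_distance C (span {u}) (span {CD a (- b)})"
    using u ab by (rule conjugate_at_distance_3)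
  also have "\<dots> \<le> graph_diameter C"
    unfolding graph_diameter_def
    using u conjugate_at_distance_3(1)[OF u ab] by (intro SUP_upper2[of "span {u}"] SUP_upper)
  finally show "3 \<le> graph_diameter C" .
qed

end

theorem theorem4p11:
  shows "\<forall>C \<in> connected_components sedenion_orthogonality_graph. graph_diameter C = 3"
  using orthogonality_component.diameter_eq_3 orthogonality_component.intro by blast

end
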